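(* Let $X$ be a random variable with values in a separable metric space $\mathcal{H}$ and let $Y$ be a categorical random variable with levels $\{1,\ldots,K\}$. The dependence coefficient $\psi(X,Y)$ satisfies: (M1) $0\le\psi(X,Y)\le 1$; (M2) $\psi(X,Y)=0$ if and only if $X$ and $Y$ are independent; (M3) $\psi(X,Y)=1$ if and only if there is a measurable function $h:\mathcal{H}\to\{1,\ldots,K\}$ such that $Y=h(X)$ almost surely. Moreover, $\psi(X,Y)=\psi(X,\ell(Y))$ for every bijection $\ell\in\mathcal{L}_Y$.
   Context: $(\mathcal{H},d)$ is a separable metric space; $K\ge 2$ and $p_k=P(Y=k)>0$ for $k=1,\ldots,K$. $\mathcal{L}_Y$ is the set of bijections from the set of levels of $Y$ onto $\{1,\ldots,K\}$. Let $Q_k(X)=P(Y=k\mid X)$ and $f(x,u)=\min\{k\in\{1,\ldots,K\}:\sum_{j=1}^kQ_j(x)>u\}$. Let $U,U'$ be uniform on $(0,1)$ with $X,U,U'$ independent. Since $(f(X,U),X)$ has the same distribution as $(Y,X)$, one assumes $Y=f(X,U)$, and sets $Y'=f(X,U')$ (so that, conditionally on $X$, $Y$ and $Y'$ are i.i.d.). Put $p_{i,j}=P(Y=i,Y'=j)$, $p_i=P(Y=i)$, $q_j=P(Y'=j)=p_j$. The coefficient is defined by $$\psi(X,Y)=\frac{1}{K-1}\sum_{i,j=1}^K\frac{(p_{i,j}-p_iq_j)^2}{p_iq_j}.$$ *)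

theory Defs
  imports "HOL-Probability.Probability"
begin

text \<open>
  \<open>is_cond_probs M K X Y Q\<close>: for each level \<open>k\<close>, \<open>Q k\<close> is a version of \<open>x \<mapsto> P(Y = k | X = x)\<close>, i.e.
  a measurable function with \<open>Q k (X) = P(Y = k | X)\<close> almost surely, where conditioning on \<open>X\<close> means
  conditioning on the sigma-algebra generated by \<open>X\<close>.
\<close>
definition is_cond_probs ::
  "'w measure \<Rightarrow> nat \<Rightarrow> ('w \<Rightarrow> 'h::metric_space) \<Rightarrow> ('w \<Rightarrow> nat) \<Rightarrow> (nat \<Rightarrow> 'h \<Rightarrow> real) \<Rightarrow> bool" where
  "is_cond_probs M K X Y Q \<longleftrightarrow>
     (\<forall>k\<in>{1..K}. Q k \<in> borel_measurable borel \<and>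
        (AE w in M. Q k (X w) =
           real_cond_exp M (vimage_algebra (space M) X borel) (indicator {v \<in> space M. Y v = k}) w))"

text \<open>A choice of versions. These exist and are unique only up to null sets of the law of \<open>X\<close>; see
  \<open>cond_probs\<close> and \<open>psi_eq_version\<close> below.\<close>
definition cond_probs ::
  "'w measure \<Rightarrow> nat \<Rightarrow> ('w \<Rightarrow> 'h::metric_space) \<Rightarrow> ('w \<Rightarrow> nat) \<Rightarrow> nat \<Rightarrow> 'h \<Rightarrow> real" where
  "cond_probs M K X Y = (SOME Q. is_cond_probs M K X Y Q)"

text \<open>For \<open>u\<close> in \<open>(0, 1)\<close> the minimum is over a nonempty set for almost all \<open>x\<close>, as there the \<open>Q j x\<close> sum to 1.\<close>
definition level_fun :: "nat \<Rightarrow> (nat \<Rightarrow> 'h \<Rightarrow> real) \<Rightarrow> 'h \<Rightarrow> real \<Rightarrow> nat" where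
  "level_fun K Q x u = Min {k \<in> {1..K}. (\<Sum>j=1..k. Q j x) > u}"

definition uniform01 :: "real measure" where
  "uniform01 = uniform_measure lborel {0<..<1}"

text \<open>The normalised chi-square functional of a pair of random variables with values in \<open>{1..K}\<close>.\<close>
definition contingency ::
  "'w measure \<Rightarrow> nat \<Rightarrow> ('w \<Rightarrow> nat) \<Rightarrow> ('w \<Rightarrow> nat) \<Rightarrow> real" where
  "contingency N K Y Y' =
     (let pp = (\<lambda>i j. measure N {w \<in> space N. Y w = i \<and> Y' w = j});
          p = (\<lambda>i. measure N {w \<in> space N. Y w = i});
          q = (\<lambda>j. measure N {w \<in> space N. Y' w = j})
      in 1 / (real K - 1) * (\<Sum>i=1..K. \<Sum>j=1..K. (pp i j - p i * q j)\<^sup>2 / (p i * q j)))"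

text \<open>
  The space carrying \<open>(X, Y)\<close> is enlarged by two uniform variables \<open>u\<close>, \<open>u'\<close> such that \<open>X\<close>, \<open>u\<close>, \<open>u'\<close> are
  independent. On it, \<open>Y\<close> is replaced by \<open>level_fun K Q X u\<close>, for which \<open>(X, Y)\<close> has the same law as
  before, and \<open>Y'\<close> is \<open>level_fun K Q X u'\<close>. This makes the coefficient depend on the law of \<open>(X, Y)\<close> only.
\<close>
definition psi_version ::
  "'w measure \<Rightarrow> nat \<Rightarrow> ('w \<Rightarrow> 'h) \<Rightarrow> (nat \<Rightarrow> 'h \<Rightarrow> real) \<Rightarrow> real" where
  "psi_version M K X Q =
     contingency (M \<Otimes>\<^sub>M (uniform01 \<Otimes>\<^sub>M uniform01)) K
       (\<lambda>(w, u, u'). level_fun K Q (X w) u)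
       (\<lambda>(w, u, u'). level_fun K Q (X w) u')"

definition psi ::
  "'w measure \<Rightarrow> nat \<Rightarrow> ('w \<Rightarrow> 'h::metric_space) \<Rightarrow> ('w \<Rightarrow> nat) \<Rightarrow> real" where
  "psi M K X Y = psi_version M K X (cond_probs M K X Y)"

text \<open>Independence of two random variables as independence of the generated sigma-algebras. The library's
  \<open>indep_var\<close> is defined that way but needs both variables to have the same value type.\<close>
definition indep_rvs ::
  "'w measure \<Rightarrow> 'a measure \<Rightarrow> ('w \<Rightarrow> 'a) \<Rightarrow> 'b measure \<Rightarrow> ('w \<Rightarrow> 'b) \<Rightarrow> bool" where
  "indep_rvs M S X T Y \<longleftrightarrow>
     prob_space.indep_set M (sets (vimage_algebra (space M) X S)) (sets (vimage_algebra (space M) Y T))"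

lemma is_cond_probs_exists:
  fixes X :: "'w \<Rightarrow> 'h::metric_space"
  assumes "prob_space M" and [measurable]: "X \<in> borel_measurable M"
    and Y[measurable]: "Y \<in> measurable M (count_space {1..K})"
  shows "\<exists>Q. is_cond_probs M K X Y Q"
proof -
  interpret prob_space M by fact
  let ?F = "vimage_algebra (space M) X borel"
  let ?D = "distr M borel X"
  interpret D: prob_space ?D by (rule prob_space_distr) simp
  have sub: "subalgebra M ?F"
    unfolding subalgebra_def by (auto simp: sets_vimage_algebra2)
  interpret S: finite_measure_subalgebra M ?F
    by unfold_locales (rule sub)
  have UB: "(UNIV :: 'h set) \<in> sets borel" by simp
  define E where "E k = {v \<in> space M. Y v = k}" for k
  define N where "N k = distr (density M (indicator (E k))) borel X" for k
  define Q where "Q k x = enn2real (RN_deriv ?D (N k) x)" for k x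
  have E[measurable]: "E k \<in> sets M" for k
  proof -
    have "E k = Y -` ({k} \<inter> {1..K}) \<inter> space M"
      using measurable_space[OF Y] by (auto simp: E_def)
    then show ?thesis by (metis Y measurable_sets sets_count_space PowI inf_le2)
  qed
  have N_em: "emeasure (N k) B = emeasure M (E k \<inter> (X -` B \<inter> space M))" if [measurable]: "B \<in> sets borel" for k B
  proof -
    have "emeasure (N k) B = (\<integral>\<^sup>+x. indicator (E k) x * indicator (X -` B \<inter> space M) x \<partial>M)"
      unfolding N_def by (subst emeasure_distr) (auto simp: emeasure_density)
    also have "\<dots> = (\<integral>\<^sup>+x. indicator (E k \<inter> (X -` B \<inter> space M)) x \<partial>M)"
      by (intro nn_integral_cong) (auto split: split_indicator)
    finally show ?thesis by simp
  qed
  have ac: "absolutely_continuous ?D (N k)" for k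
    unfolding absolutely_continuous_def
  proof
    fix B assume B: "B \<in> null_sets ?D"
    then have [measurable]: "B \<in> sets borel" by auto
    have "emeasure M (X -` B \<inter> space M) = 0" using B by (auto simp: null_sets_def emeasure_distr)
    moreover have "emeasure M (E k \<inter> (X -` B \<inter> space M)) \<le> emeasure M (X -` B \<inter> space M)"
      by (rule emeasure_mono) auto
    ultimately have "emeasure (N k) B = 0" by (simp add: N_em)
    then show "B \<in> null_sets (N k)" by (intro null_setsI) (auto simp: N_def)
  qed
  have finN: "finite_measure (N k)" for k
  proof
    have "emeasure (N k) UNIV < \<infinity>" unfolding N_em[OF UB] by (simp add: less_top[symmetric])
    then show "emeasure (N k) (space (N k)) \<noteq> \<infinity>" by (simp add: N_def)
  qed
  have Qm[measurable]: "Q k \<in> borel_measurable borel" for k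
  proof -
    have "RN_deriv ?D (N k) \<in> borel_measurable ?D" by (rule borel_measurable_RN_deriv)
    then have [measurable]: "RN_deriv ?D (N k) \<in> borel_measurable borel" by simp
    show ?thesis unfolding Q_def by measurable
  qed
  have fin: "AE x in ?D. RN_deriv ?D (N k) x \<noteq> \<infinity>" for k
    using D.RN_deriv_finite[of "N k"] finN[of k] ac[of k]
    by (simp add: N_def finite_measure.sigma_finite_measure)
  have em: "(\<integral>\<^sup>+w. ennreal (Q k (X w)) * indicator (X -` B \<inter> space M) w \<partial>M)
      = emeasure M (E k \<inter> (X -` B \<inter> space M))" if [measurable]: "B \<in> sets borel" for k B
  proof -
    have "(\<integral>\<^sup>+w. ennreal (Q k (X w)) * indicator (X -` B \<inter> space M) w \<partial>M)
        = (\<integral>\<^sup>+w. ennreal (Q k (X w)) * indicator B (X w) \<partial>M)"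
      by (intro nn_integral_cong) (auto split: split_indicator)
    also have "\<dots> = (\<integral>\<^sup>+x. ennreal (Q k x) * indicator B x \<partial>?D)"
      by (subst nn_integral_distr) auto
    also have "\<dots> = (\<integral>\<^sup>+x. RN_deriv ?D (N k) x * indicator B x \<partial>?D)"
      using fin[of k] by (intro nn_integral_cong_AE) (auto simp: Q_def less_top)
    also have "\<dots> = emeasure (density ?D (RN_deriv ?D (N k))) B"
      by (subst emeasure_density) auto
    also have "density ?D (RN_deriv ?D (N k)) = N k"
      by (rule D.density_RN_deriv) (use ac in \<open>auto simp: N_def\<close>)
    finally show ?thesis by (simp add: N_em)
  qed
  have Qint: "integrable M (\<lambda>w. Q k (X w))" for k
  proof (rule integrableI_nonneg)
    have "(\<integral>\<^sup>+w. ennreal (Q k (X w)) \<partial>M) = (\<integral>\<^sup>+w. ennreal (Q k (X w)) * indicator (X -` UNIV \<inter> space M) w \<partial>M)"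
      by (intro nn_integral_cong) auto
    also have "\<dots> < \<infinity>" unfolding em[OF UB] by (simp add: less_top[symmetric])
    finally show "(\<integral>\<^sup>+w. ennreal (Q k (X w)) \<partial>M) < \<infinity>" .
  qed (auto simp: Q_def)
  have "AE w in M. real_cond_exp M ?F (indicator (E k)) w = Q k (X w)" for k
  proof (rule S.real_cond_exp_charact)
    fix A assume "A \<in> sets ?F"
    then obtain B where B[measurable]: "B \<in> sets borel" and A: "A = X -` B \<inter> space M"
      by (auto simp: sets_vimage_algebra2)
    have [measurable]: "A \<in> sets M" unfolding A by measurable
    have "(\<integral>w\<in>A. indicator (E k) w \<partial>M) = (\<integral>w. indicator (E k \<inter> A) w \<partial>M)"
      unfolding set_lebesgue_integral_def
      by (intro Bochner_Integration.integral_cong) (auto split: split_indicator)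
    also have "\<dots> = measure M (E k \<inter> A)" by simp
    also have "\<dots> = enn2real (\<integral>\<^sup>+w. ennreal (Q k (X w)) * indicator A w \<partial>M)"
      unfolding A em[OF B] measure_def ..
    also have "\<dots> = enn2real (\<integral>\<^sup>+w. ennreal (indicator A w *\<^sub>R Q k (X w)) \<partial>M)"
      by (intro arg_cong[where f = enn2real] nn_integral_cong) (auto split: split_indicator)
    also have "\<dots> = (\<integral>w\<in>A. Q k (X w) \<partial>M)"
      unfolding set_lebesgue_integral_def
      by (subst integral_eq_nn_integral) (auto simp: Q_def)
    finally show "(\<integral>w\<in>A. indicator (E k) w \<partial>M) = (\<integral>w\<in>A. Q k (X w) \<partial>M)" .
  next
    show "(\<lambda>w. Q k (X w)) \<in> borel_measurable ?F"
      by (rule measurable_compose[OF measurable_vimage_algebra1 Qm]) auto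
    show "integrable M (indicator (E k) :: _ \<Rightarrow> real)" by (rule integrable_real_indicator) (auto simp: less_top[symmetric])
  qed (rule Qint)
  then have "AE w in M. Q k (X w) = real_cond_exp M ?F (indicator (E k)) w" for k
    by (rule eventually_mono[OF _ sym])
  then have "is_cond_probs M K X Y Q"
    unfolding is_cond_probs_def E_def[symmetric] using Qm by blast
  then show ?thesis by blast
qed

lemma cond_probs:
  fixes X :: "'w \<Rightarrow> 'h::metric_space"
  assumes "prob_space M" "X \<in> borel_measurable M" "Y \<in> measurable M (count_space {1..K})"
  shows "is_cond_probs M K X Y (cond_probs M K X Y)"
  unfolding cond_probs_def using someI_ex[OF is_cond_probs_exists[OF assms]] .

lemma prob_space_uniform01: "prob_space uniform01"
  unfolding uniform01_def by (rule prob_space_uniform_measure) auto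

lemma sets_uniform01 [measurable_cong]: "sets uniform01 = sets borel"
  by (simp add: uniform01_def)

lemma measurable_level_fun:
  fixes X :: "'w \<Rightarrow> 'h::metric_space"
  assumes [measurable]: "X \<in> borel_measurable N" "U \<in> borel_measurable N"
    and Q: "\<And>k. k \<in> {1..K} \<Longrightarrow> Q k \<in> borel_measurable borel"
  shows "(\<lambda>w. level_fun K Q (X w) (U w)) \<in> measurable N (count_space UNIV)"
proof -
  define A where "A w = {k \<in> {1..K}. (\<Sum>j=1..k. Q j (X w)) > U w}" for w
  have A: "A w \<subseteq> {1..K}" for w unfolding A_def by blast
  have *: "{w \<in> space N. k \<in> A w} \<in> sets N" for k
  proof (cases "k \<in> {1..K}")
    case True
    have S: "(\<lambda>w. \<Sum>j=1..k. Q j (X w)) \<in> borel_measurable N"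
      using True by (intro borel_measurable_sum measurable_compose[OF assms(1) Q]) auto
    have "{w \<in> space N. k \<in> A w} = {w \<in> space N. U w < (\<Sum>j=1..k. Q j (X w))}"
      using True unfolding A_def by blast
    then show ?thesis using borel_measurable_less[OF assms(2) S] by (simp only:)
  next
    case False
    then have "{w \<in> space N. k \<in> A w} = {}" unfolding A_def by blast
    then show ?thesis by (simp only: sets.empty_sets)
  qed
  have **: "{w \<in> space N. A w = B} \<in> sets N" for B
  proof (cases "B \<subseteq> {1..K}")
    case True
    have "{w \<in> space N. A w = B} = {w \<in> space N. \<forall>k\<in>{1..K}. (k \<in> A w) = (k \<in> B)}"
      using True A by blast
    moreover have "{w \<in> space N. \<forall>k\<in>{1..K}. (k \<in> A w) = (k \<in> B)} \<in> sets N"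
    proof (rule sets.sets_Collect_finite_All)
      show "{w \<in> space N. (k \<in> A w) = (k \<in> B)} \<in> sets N" for k
        using *[of k] sets.sets_Collect_neg[OF *[of k]] by (cases "k \<in> B") simp_all
    qed simp
    ultimately show ?thesis by (simp only:)
  next
    case False
    then have "{w \<in> space N. A w = B} = {}" using A by blast
    then show ?thesis by (simp only: sets.empty_sets)
  qed
  have "A -` {B} \<inter> space N \<in> sets N" for B
  proof -
    have "A -` {B} \<inter> space N = {w \<in> space N. A w = B}" by blast
    then show ?thesis using **[of B] by (simp only:)
  qed
  then have "A \<in> measurable N (count_space (Pow {1..K}))"
    using A by (subst measurable_count_space_eq2) auto
  then have "(\<lambda>w. Min (A w)) \<in> measurable N (count_space UNIV)"
    by (rule measurable_compose) simp
  then show ?thesis unfolding level_fun_def A_def .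
qed

lemma psi_version_eq:
  fixes X :: "'w \<Rightarrow> 'h::metric_space"
  assumes "prob_space M" and X[measurable]: "X \<in> borel_measurable M"
    and "is_cond_probs M K X Y Q" "is_cond_probs M K X Y R"
  shows "psi_version M K X Q = psi_version M K X R"
proof -
  interpret prob_space M by fact
  interpret U: prob_space uniform01 by (rule prob_space_uniform01)
  interpret UU: pair_prob_space uniform01 uniform01 ..
  interpret P: pair_prob_space M "uniform01 \<Otimes>\<^sub>M uniform01" ..
  let ?N = "M \<Otimes>\<^sub>M (uniform01 \<Otimes>\<^sub>M uniform01)"
  let ?f = "\<lambda>Q (w, u, u'). level_fun K Q (X w) u"
  let ?g = "\<lambda>Q (w, u, u'). level_fun K Q (X w) u'"
  have m: "?f S \<in> measurable ?N (count_space UNIV)" "?g S \<in> measurable ?N (count_space UNIV)"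
    if "is_cond_probs M K X Y S" for S
    using that unfolding split_def is_cond_probs_def
    by (intro measurable_level_fun; simp)+
  have sets_T: "{z \<in> space ?N. T (?f S z) (?g S z)} \<in> sets ?N"
    if "is_cond_probs M K X Y S" for S and T :: "nat \<Rightarrow> nat \<Rightarrow> bool"
  proof -
    have "{z \<in> space ?N. T (?f S z) (?g S z)} =
        (\<Union>a. \<Union>b\<in>{b. T a b}. (?f S -` {a} \<inter> space ?N) \<inter> (?g S -` {b} \<inter> space ?N))"
      by blast
    also have "\<dots> \<in> sets ?N"
    proof (intro sets.countable_UN'' countableI_type)
      show "(?f S -` {a} \<inter> space ?N) \<inter> (?g S -` {b} \<inter> space ?N) \<in> sets ?N" for a b
        by (rule sets.Int[OF measurable_sets[OF m(1)[OF that]] measurable_sets[OF m(2)[OF that]]]) simp_all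
    qed
    finally show ?thesis .
  qed
  have "AE w in M. Q k (X w) = R k (X w)" if "k \<in> {1..K}" for k
    using assms(3,4)[unfolded is_cond_probs_def, rule_format, OF that, THEN conjunct2]
    by eventually_elim simp
  then have "AE w in M. \<forall>k\<in>{1..K}. Q k (X w) = R k (X w)"
    by (intro AE_finite_allI) auto
  then have "AE w in M. \<forall>u. level_fun K Q (X w) u = level_fun K R (X w) u"
  proof eventually_elim
    case (elim w)
    then have "(\<Sum>j=1..k. Q j (X w)) = (\<Sum>j=1..k. R j (X w))" if "k \<in> {1..K}" for k
      using that by (intro sum.cong) auto
    then have "{k \<in> {1..K}. u < (\<Sum>j=1..k. Q j (X w))} = {k \<in> {1..K}. u < (\<Sum>j=1..k. R j (X w))}" for u
      by auto
    then show ?case unfolding level_fun_def by simp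
  qed
  then have "AE w in distr ?N M fst. \<forall>u. level_fun K Q (X w) u = level_fun K R (X w) u"
    by (simp only: prob_space.distr_pair_fst[OF prob_space_pair[OF prob_space_uniform01 prob_space_uniform01]])
  then have AE1: "AE z in ?N. \<forall>u. level_fun K Q (X (fst z)) u = level_fun K R (X (fst z)) u"
    by (rule AE_distrD[OF measurable_fst])
  have AE: "AE z in ?N. ?f Q z = ?f R z \<and> ?g Q z = ?g R z"
    using AE1 by eventually_elim auto
  have "measure ?N {z \<in> space ?N. T (?f Q z) (?g Q z)} = measure ?N {z \<in> space ?N. T (?f R z) (?g R z)}"
    for T :: "nat \<Rightarrow> nat \<Rightarrow> bool"
  proof (rule measure_eq_AE)
    show "AE z in ?N. (z \<in> {z \<in> space ?N. T (?f Q z) (?g Q z)}) = (z \<in> {z \<in> space ?N. T (?f R z) (?g R z)})"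
      using AE by eventually_elim auto
  qed (rule sets_T[OF assms(3)], rule sets_T[OF assms(4)])
  then have "measure ?N {z \<in> space ?N. ?f Q z = i \<and> ?g Q z = j} = measure ?N {z \<in> space ?N. ?f R z = i \<and> ?g R z = j}"
      "measure ?N {z \<in> space ?N. ?f Q z = i} = measure ?N {z \<in> space ?N. ?f R z = i}"
      "measure ?N {z \<in> space ?N. ?g Q z = j} = measure ?N {z \<in> space ?N. ?g R z = j}" for i j
    by assumption+
  then show ?thesis unfolding psi_version_def contingency_def Let_def by (simp only:)
qed

lemma psi_eq_version:
  fixes X :: "'w \<Rightarrow> 'h::metric_space"
  assumes "prob_space M" "X \<in> borel_measurable M" "Y \<in> measurable M (count_space {1..K})"
    and "is_cond_probs M K X Y Q"
  shows "psi M K X Y = psi_version M K X Q"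
  unfolding psi_def using psi_version_eq[OF assms(1,2) cond_probs[OF assms(1-3)] assms(4)] .

end

theory Submission
  imports Defs
begin

text \<open>
  Write \<open>R\<^sub>k = Q\<^sub>k(X)\<close> and \<open>p\<^sub>k = P(Y = k)\<close>. Given \<open>X\<close>, the two copies of \<open>Y\<close> are i.i.d. with weights
  \<open>R\<^sub>k\<close>, so that \<open>p\<^sub>i\<^sub>j = E[R\<^sub>i R\<^sub>j]\<close>. Expanding the square gives
  \<open>(K - 1)(1 - \<psi>) = \<Sum>\<^sub>i\<^sub>j p\<^sub>i\<^sub>j (p\<^sub>i - p\<^sub>i\<^sub>j) / (p\<^sub>i p\<^sub>j)\<close>, which is nonnegative as \<open>p\<^sub>i\<^sub>j \<le> p\<^sub>i\<close>.
  The diagonal terms decide the extreme cases: \<open>\<psi> = 0\<close> forces \<open>Var R\<^sub>i = 0\<close>, i.e. \<open>R\<^sub>i = p\<^sub>i\<close> almost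
  surely, and \<open>\<psi> = 1\<close> forces \<open>E[R\<^sub>i (1 - R\<^sub>i)] = 0\<close>, i.e. \<open>R\<^sub>i \<in> {0, 1}\<close> almost surely.
\<close>

section \<open>Algebra of the chi-square sum\<close>

lemma sum_sum_nonneg_eq_0_iff:
  fixes f :: "'a \<Rightarrow> 'a \<Rightarrow> real"
  assumes "finite A" "\<And>i j. i \<in> A \<Longrightarrow> j \<in> A \<Longrightarrow> 0 \<le> f i j"
  shows "(\<Sum>i\<in>A. \<Sum>j\<in>A. f i j) = 0 \<longleftrightarrow> (\<forall>i\<in>A. \<forall>j\<in>A. f i j = 0)"
  using assms by (simp add: sum_nonneg_eq_0_iff sum_nonneg)

text \<open>Adding \<open>c i j * (p i - c i j) / (p i * p j)\<close> to a chi-square term cancels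
  the part quadratic in \<open>c i j\<close> and leaves
  \<open>c i j / p j - 2 * c i j + p i * p j\<close>. Its three parts sum to \<open>card A\<close>,
  -2 and 1.\<close>

lemma chi_square_eq:
  fixes c :: "'a \<Rightarrow> 'a \<Rightarrow> real" and p :: "'a \<Rightarrow> real"
  assumes "finite A" and pos: "\<And>i. i \<in> A \<Longrightarrow> 0 < p i" and sum_p: "(\<Sum>i\<in>A. p i) = 1"
    and sym: "\<And>i j. c i j = c j i" and row: "\<And>i. i \<in> A \<Longrightarrow> (\<Sum>j\<in>A. c i j) = p i"
  shows "(\<Sum>i\<in>A. \<Sum>j\<in>A. (c i j - p i * p j)\<^sup>2 / (p i * p j)) =
    real (card A) - 1 - (\<Sum>i\<in>A. \<Sum>j\<in>A. c i j * (p i - c i j) / (p i * p j))"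
proof -
  have "(\<Sum>i\<in>A. \<Sum>j\<in>A. (c i j - p i * p j)\<^sup>2 / (p i * p j)) +
      (\<Sum>i\<in>A. \<Sum>j\<in>A. c i j * (p i - c i j) / (p i * p j)) =
      (\<Sum>i\<in>A. \<Sum>j\<in>A. c i j / p j - 2 * c i j + p i * p j)"
    unfolding sum.distrib[symmetric]
  proof (intro sum.cong refl)
    fix i j assume "i \<in> A" "j \<in> A"
    then have "p i \<noteq> 0" "p j \<noteq> 0" using pos by force+
    then show "(c i j - p i * p j)\<^sup>2 / (p i * p j) + c i j * (p i - c i j) / (p i * p j) =
        c i j / p j - 2 * c i j + p i * p j"
      by (simp add: field_simps power2_eq_square)
  qed
  also have "\<dots> = (\<Sum>i\<in>A. \<Sum>j\<in>A. c i j / p j) - 2 * (\<Sum>i\<in>A. \<Sum>j\<in>A. c i j) + (\<Sum>i\<in>A. \<Sum>j\<in>A. p i * p j)"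
    by (simp add: sum.distrib sum_subtractf sum_distrib_left)
  also have "(\<Sum>i\<in>A. \<Sum>j\<in>A. c i j) = 1"
    using row sum_p by simp
  also have "(\<Sum>i\<in>A. \<Sum>j\<in>A. p i * p j) = 1"
    by (simp add: sum_p flip: sum_distrib_left)
  \<comment> \<open>After swapping the sums, symmetry turns column sums of \<open>c\<close> into row
    sums, so each \<open>j\<close> contributes \<open>p j / p j\<close>.\<close>
  also have "(\<Sum>i\<in>A. \<Sum>j\<in>A. c i j / p j) = (\<Sum>j\<in>A. (\<Sum>i\<in>A. c j i) / p j)"
    by (subst sum.swap) (simp add: sym[of _ j for j] sum_divide_distrib)
  also have "\<dots> = (\<Sum>j\<in>A. 1)"
    using pos by (intro sum.cong) (force simp: row)+
  finally show ?thesis by simp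
qed

section \<open>The level function evaluated at a uniform variable\<close>

lemma level_fun_eq_iff:
  assumes nonneg: "\<And>k. k \<in> {1..K} \<Longrightarrow> 0 \<le> Q k x" and total: "(\<Sum>k=1..K. Q k x) = 1"
    and i: "i \<in> {1..K}" and u: "0 < u" "u < 1"
  shows "level_fun K Q x u = i \<longleftrightarrow> (\<Sum>j=1..i-1. Q j x) \<le> u \<and> u < (\<Sum>j=1..i. Q j x)"
proof -
  let ?A = "{k \<in> {1..K}. u < (\<Sum>j=1..k. Q j x)}"
  \<comment> \<open>Because the partial sums are nondecreasing, \<open>?A\<close> is an upper
    segment of \<open>{1..K}\<close>, so its minimum is determined by comparing \<open>u\<close>
    with two consecutive partial sums.\<close>
  have mono: "(\<Sum>j=1..k. Q j x) \<le> (\<Sum>j=1..l. Q j x)" if "k \<le> l" "l \<le> K" for k l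
    using that by (intro sum_mono2) (auto intro: nonneg)
  have "K \<in> ?A" using i u total by auto
  then have "?A \<noteq> {}" "finite ?A" by auto
  then have "level_fun K Q x u = i \<longleftrightarrow> i \<in> ?A \<and> (\<forall>k\<in>?A. i \<le> k)"
    unfolding level_fun_def by (subst Min_eq_iff) auto
  also have "(\<forall>k\<in>?A. i \<le> k) \<longleftrightarrow> (\<Sum>j=1..i-1. Q j x) \<le> u"
  proof
    assume *: "\<forall>k\<in>?A. i \<le> k"
    show "(\<Sum>j=1..i-1. Q j x) \<le> u"
    \<comment> \<open>For \<open>i = 1\<close> the predecessor 0 is not a level, so nothing can be
      read off \<open>?A\<close>; the sum is then empty and the bound is just
      \<open>0 \<le> u\<close>.\<close>
    proof (cases "i = 1")
      case False
      then have "i - 1 \<notin> ?A" using * i by fastforce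
      then show ?thesis using i False by auto
    qed (use u in simp)
  next
    assume *: "(\<Sum>j=1..i-1. Q j x) \<le> u"
    show "\<forall>k\<in>?A. i \<le> k"
    proof (rule ccontr)
      assume "\<not> (\<forall>k\<in>?A. i \<le> k)"
      then obtain k where "k \<in> ?A" "k \<le> i - 1" by force
      then show False using mono[of k "i - 1"] * i by force
    qed
  qed
  finally show ?thesis using i by auto
qed

text \<open>The thresholds cut out an interval of values \<open>u\<close> whose length is the
  increment of the partial sums at \<open>i\<close>.\<close>

lemma emeasure_uniform01_level_fun:
  assumes nonneg: "\<And>k. k \<in> {1..K} \<Longrightarrow> 0 \<le> Q k x" and total: "(\<Sum>k=1..K. Q k x) = 1"
    and i: "i \<in> {1..K}" and m: "{u. level_fun K Q x u = i} \<in> sets borel"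
  shows "emeasure uniform01 {u. level_fun K Q x u = i} = ennreal (Q i x)"
proof -
  define a where "a = (\<Sum>j=1..i-1. Q j x)"
  have b: "(\<Sum>j=1..i. Q j x) = a + Q i x"
    using i by (cases i) (auto simp: a_def)
  have "0 \<le> a" unfolding a_def using i by (intro sum_nonneg nonneg) auto
  have "a + Q i x \<le> 1"
    unfolding b[symmetric] total[symmetric] using i by (intro sum_mono2) (auto intro: nonneg)
  have iff: "level_fun K Q x u = i \<longleftrightarrow> a \<le> u \<and> u < a + Q i x" if "0 < u" "u < 1" for u
    using level_fun_eq_iff[of K Q x, OF nonneg total i that] by (simp only: b a_def)
  have "{0<..<1} \<inter> {u. level_fun K Q x u = i} = {0<..<1} \<inter> {a..<a + Q i x}"
    unfolding set_eq_iff Int_iff greaterThanLessThan_iff mem_Collect_eq atLeastLessThan_iff using iff by blast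
  \<comment> \<open>Intersecting with the open unit interval removes the left endpoint when
    \<open>a = 0\<close>; the length is \<open>Q i x\<close> in either case.\<close>
  also have "\<dots> = (if a = 0 then {0<..<a + Q i x} else {a..<a + Q i x})"
    using \<open>0 \<le> a\<close> \<open>a + Q i x \<le> 1\<close> by auto
  finally have "emeasure lborel ({0<..<1} \<inter> {u. level_fun K Q x u = i}) = ennreal (Q i x)"
    using nonneg[OF i] by (simp split: if_split_asm)
  then show ?thesis
    using m unfolding uniform01_def
    by (subst emeasure_uniform_measure) (auto simp: divide_ennreal_def)
qed

section \<open>Conditional probabilities of the levels given \<open>X\<close>\<close>

context
  fixes M :: "'w measure" and X :: "'w \<Rightarrow> 'h::metric_space" and Y :: "'w \<Rightarrow> nat" and K :: nat
  assumes M: "prob_space M" and X[measurable]: "X \<in> borel_measurable M"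
    and Y: "Y \<in> measurable M (count_space {1..K})"
begin

interpretation prob_space M by (rule M)

lemma level_event [measurable]: "{w \<in> space M. Y w = k} \<in> sets M"
proof -
  have "{w \<in> space M. Y w = k} = Y -` ({k} \<inter> {1..K}) \<inter> space M"
    using measurable_space[OF Y] by auto
  also have "\<dots> \<in> sets M"
    by (rule measurable_sets[OF Y]) simp
  finally show ?thesis .
qed

text \<open>Sets of the sigma-algebra generated by \<open>X\<close> are preimages of Borel sets, so
  the defining property of conditional expectation can be tested by integrating against
  \<open>indicator B (X w)\<close>. In this form explicit candidates for \<open>Q\<close> can be
  verified, as is done later for constants, for indicators of fibres and for permuted
  levels.\<close>

lemma is_cond_probs_iff:
  "is_cond_probs M K X Y Q \<longleftrightarrow>
    (\<forall>k\<in>{1..K}. Q k \<in> borel_measurable borel \<and> integrable M (\<lambda>w. Q k (X w)) \<and>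
      (\<forall>B\<in>sets borel. (\<integral>w. indicator B (X w) * Q k (X w) \<partial>M) = prob {w \<in> space M. Y w = k \<and> X w \<in> B}))"
  (is "_ = (\<forall>k\<in>{1..K}. ?char k)")
proof -
  let ?F = "vimage_algebra (space M) X borel"
  interpret S: finite_measure_subalgebra M ?F
    by unfold_locales (auto simp: subalgebra_def sets_vimage_algebra2)
  let ?f = "\<lambda>k. indicator {w \<in> space M. Y w = k} :: 'w \<Rightarrow> real"
  have int_f: "integrable M (?f k)" for k
    by (rule integrable_real_indicator) (auto simp: less_top[symmetric])
  have f_int: "(\<integral>w\<in>X -` B \<inter> space M. ?f k w \<partial>M) = prob {w \<in> space M. Y w = k \<and> X w \<in> B}"
    if [measurable]: "B \<in> sets borel" for k B
  proof -
    have "(\<integral>w\<in>X -` B \<inter> space M. ?f k w \<partial>M) =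
        (\<integral>w. indicator ({w \<in> space M. Y w = k} \<inter> (X -` B \<inter> space M)) w \<partial>M)"
      unfolding set_lebesgue_integral_def
      by (intro Bochner_Integration.integral_cong) (auto split: split_indicator)
    also have "\<dots> = prob ({w \<in> space M. Y w = k} \<inter> (X -` B \<inter> space M))"
      by simp
    also have "{w \<in> space M. Y w = k} \<inter> (X -` B \<inter> space M) = {w \<in> space M. Y w = k \<and> X w \<in> B}"
      by auto
    finally show ?thesis .
  qed
  have g_int: "(\<integral>w\<in>X -` B \<inter> space M. g w \<partial>M) = (\<integral>w. indicator B (X w) * g w \<partial>M)" for B and g :: "'w \<Rightarrow> real"
    unfolding set_lebesgue_integral_def
    by (intro Bochner_Integration.integral_cong) (auto split: split_indicator)
  have "(Q k \<in> borel_measurable borel \<and> (AE w in M. Q k (X w) = real_cond_exp M ?F (?f k) w)) = ?char k" for k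
  proof (intro iffI conjI; elim conjE)
    assume Q[measurable]: "Q k \<in> borel_measurable borel" and ae: "AE w in M. Q k (X w) = real_cond_exp M ?F (?f k) w"
    show "integrable M (\<lambda>w. Q k (X w))"
      using S.real_cond_exp_int(1)[OF int_f, of k] ae
      by (subst integrable_cong_AE[where g = "real_cond_exp M ?F (?f k)"]) auto
    show "\<forall>B\<in>sets borel. (\<integral>w. indicator B (X w) * Q k (X w) \<partial>M) = prob {w \<in> space M. Y w = k \<and> X w \<in> B}"
    proof
      fix B :: "'h set" assume B[measurable]: "B \<in> sets borel"
      have "(\<integral>w\<in>X -` B \<inter> space M. ?f k w \<partial>M) = (\<integral>w\<in>X -` B \<inter> space M. real_cond_exp M ?F (?f k) w \<partial>M)"
        by (rule S.real_cond_exp_intA[OF int_f]) (use B in \<open>auto simp: sets_vimage_algebra2\<close>)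
      also have "\<dots> = (\<integral>w. indicator B (X w) * real_cond_exp M ?F (?f k) w \<partial>M)" by (rule g_int)
      also have "\<dots> = (\<integral>w. indicator B (X w) * Q k (X w) \<partial>M)"
        using ae by (intro integral_cong_AE) auto
      finally show "(\<integral>w. indicator B (X w) * Q k (X w) \<partial>M) = prob {w \<in> space M. Y w = k \<and> X w \<in> B}"
        by (simp add: f_int)
    qed
  next
    assume Q[measurable]: "Q k \<in> borel_measurable borel" and int: "integrable M (\<lambda>w. Q k (X w))"
      and eq: "\<forall>B\<in>sets borel. (\<integral>w. indicator B (X w) * Q k (X w) \<partial>M) = prob {w \<in> space M. Y w = k \<and> X w \<in> B}"
    have "AE w in M. real_cond_exp M ?F (?f k) w = Q k (X w)"
    proof (rule S.real_cond_exp_charact)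
      fix A assume "A \<in> sets ?F"
      then obtain B where B: "B \<in> sets borel" and A: "A = X -` B \<inter> space M"
        by (auto simp: sets_vimage_algebra2)
      show "(\<integral>w\<in>A. ?f k w \<partial>M) = (\<integral>w\<in>A. Q k (X w) \<partial>M)"
        unfolding A by (simp only: f_int[OF B] g_int[of _ "\<lambda>w. Q k (X w)"] eq[rule_format, OF B])
    next
      show "(\<lambda>w. Q k (X w)) \<in> borel_measurable ?F"
        by (rule measurable_compose[OF measurable_vimage_algebra1 Q]) auto
    qed (use int_f int in auto)
    then show "AE w in M. Q k (X w) = real_cond_exp M ?F (?f k) w"
      by (rule eventually_mono[OF _ sym])
  qed
  then show ?thesis unfolding is_cond_probs_def by blast
qed

context
  fixes Q :: "nat \<Rightarrow> 'h \<Rightarrow> real"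
  assumes Q: "is_cond_probs M K X Y Q"
begin

lemma cond_probs_measurable: "k \<in> {1..K} \<Longrightarrow> Q k \<in> borel_measurable borel"
  by (rule is_cond_probs_iff[THEN iffD1, OF Q, THEN bspec, THEN conjunct1])

lemma cond_probs_integrable: "k \<in> {1..K} \<Longrightarrow> integrable M (\<lambda>w. Q k (X w))"
  by (rule is_cond_probs_iff[THEN iffD1, OF Q, THEN bspec, THEN conjunct2, THEN conjunct1])

lemma cond_probs_integral: "k \<in> {1..K} \<Longrightarrow> B \<in> sets borel \<Longrightarrow>
    (\<integral>w. indicator B (X w) * Q k (X w) \<partial>M) = prob {w \<in> space M. Y w = k \<and> X w \<in> B}"
  by (rule is_cond_probs_iff[THEN iffD1, OF Q, THEN bspec, THEN conjunct2, THEN conjunct2, THEN bspec])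

lemma cond_probs_expectation:
  "k \<in> {1..K} \<Longrightarrow> (\<integral>w. Q k (X w) \<partial>M) = prob {w \<in> space M. Y w = k}"
  using cond_probs_integral[of k UNIV] by simp

lemma cond_probs_compose_measurable: "k \<in> {1..K} \<Longrightarrow> (\<lambda>w. Q k (X w)) \<in> borel_measurable M"
  by (rule measurable_compose[OF X cond_probs_measurable])

text \<open>A version is determined only up to null sets, hence the \<open>AE\<close>. The
  quantifier over the finitely many levels stands inside it because later arguments use all levels
  at the same point.\<close>

lemma AE_cond_probs_nonneg: "AE w in M. \<forall>k\<in>{1..K}. 0 \<le> Q k (X w)"
proof (rule AE_finite_allI)
  let ?F = "vimage_algebra (space M) X borel"
  interpret S: finite_measure_subalgebra M ?F
    by unfold_locales (auto simp: subalgebra_def sets_vimage_algebra2)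
  fix k assume k: "k \<in> {1..K}"
  have "AE w in M. 0 \<le> real_cond_exp M ?F (indicator {v \<in> space M. Y v = k}) w"
    by (rule S.real_cond_exp_pos) auto
  moreover have "AE w in M. Q k (X w) = real_cond_exp M ?F (indicator {v \<in> space M. Y v = k}) w"
    using Q k unfolding is_cond_probs_def by blast
  ultimately show "AE w in M. 0 \<le> Q k (X w)" by eventually_elim simp
qed simp

lemma sum_level_probs:
  assumes [measurable]: "A \<in> sets M"
  shows "(\<Sum>k=1..K. prob {w \<in> space M. Y w = k \<and> w \<in> A}) = prob A"
proof -
  have "prob (\<Union>k\<in>{1..K}. {w \<in> space M. Y w = k \<and> w \<in> A}) = (\<Sum>k=1..K. prob {w \<in> space M. Y w = k \<and> w \<in> A})"
    by (rule finite_measure_finite_Union) (auto simp: disjoint_family_on_def)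
  moreover have "(\<Union>k\<in>{1..K}. {w \<in> space M. Y w = k \<and> w \<in> A}) = A"
    using measurable_space[OF Y] sets.sets_into_space[OF assms] by auto
  ultimately show ?thesis by simp
qed

text \<open>The indicators of the levels add up to 1 at every outcome; conditional expectation is
  additive and fixes constants.\<close>

lemma AE_cond_probs_sum: "AE w in M. (\<Sum>k=1..K. Q k (X w)) = 1"
proof -
  let ?F = "vimage_algebra (space M) X borel"
  interpret S: finite_measure_subalgebra M ?F
    by unfold_locales (auto simp: subalgebra_def sets_vimage_algebra2)
  let ?f = "\<lambda>k. indicator {w \<in> space M. Y w = k} :: 'w \<Rightarrow> real"
  have int_f: "integrable M (?f k)" for k
    by (rule integrable_real_indicator) (auto simp: less_top[symmetric])
  have one: "(\<Sum>k=1..K. ?f k w) = 1" if "w \<in> space M" for w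
  proof -
    have "(\<Sum>k=1..K. ?f k w) = (\<Sum>k=1..K. if k = Y w then 1 else 0)"
      using that by (intro sum.cong) (auto simp: indicator_def)
    then show ?thesis using measurable_space[OF Y that] by simp
  qed
  have "AE w in M. real_cond_exp M ?F (\<lambda>w. \<Sum>k=1..K. ?f k w) w = (\<Sum>k=1..K. real_cond_exp M ?F (?f k) w)"
    by (rule S.real_cond_exp_sum) (rule int_f)
  moreover have "AE w in M. real_cond_exp M ?F (\<lambda>w. \<Sum>k=1..K. ?f k w) w = real_cond_exp M ?F (\<lambda>w. 1) w"
    using one by (intro S.real_cond_exp_cong) auto
  moreover have "AE w in M. real_cond_exp M ?F (\<lambda>w. 1) w = 1"
    by (rule S.real_cond_exp_F_meas) auto
  moreover have "AE w in M. \<forall>k\<in>{1..K}. Q k (X w) = real_cond_exp M ?F (?f k) w"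
    using Q unfolding is_cond_probs_def by (intro AE_finite_allI) auto
  ultimately show ?thesis by eventually_elim simp
qed

lemma AE_cond_probs_le_1: "AE w in M. \<forall>k\<in>{1..K}. Q k (X w) \<le> 1"
  using AE_cond_probs_nonneg AE_cond_probs_sum
proof eventually_elim
  case (elim w)
  show ?case
  proof
    fix k assume "k \<in> {1..K}"
    then have "Q k (X w) \<le> (\<Sum>k=1..K. Q k (X w))"
      using elim(1) by (intro member_le_sum) blast+
    then show "Q k (X w) \<le> 1" using elim(2) by simp
  qed
qed

lemma integrable_cond_probs_mult:
  assumes "i \<in> {1..K}" "j \<in> {1..K}"
  shows "integrable M (\<lambda>w. Q i (X w) * Q j (X w))"
proof (rule integrable_const_bound[where B = 1])
  show "AE w in M. norm (Q i (X w) * Q j (X w)) \<le> 1"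
    using AE_cond_probs_nonneg AE_cond_probs_le_1
  proof eventually_elim
    case (elim w)
    then have "0 \<le> Q i (X w)" "0 \<le> Q j (X w)" "Q i (X w) \<le> 1" "Q j (X w) \<le> 1"
      using assms by blast+
    then show ?case by (simp add: abs_mult mult_le_one)
  qed
qed (rule borel_measurable_times[OF assms[THEN cond_probs_compose_measurable]])

section \<open>The joint law of the two copies and its second-moment form\<close>

lemma level_fun_section_measurable: "{u. level_fun K Q x u \<in> I} \<in> sets borel"
proof -
  \<comment> \<open>With a constant in place of \<open>X\<close> and the identity in place of
    \<open>U\<close>, the general measurability result becomes measurability in \<open>u\<close> for
    fixed \<open>x\<close>.\<close>
  have "(\<lambda>u. level_fun K Q ((\<lambda>_. x) u) (id u)) \<in> measurable borel (count_space UNIV)"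
    by (rule measurable_level_fun) (simp_all only: measurable_const space_borel UNIV_I cond_probs_measurable id_def measurable_ident_sets)
  from measurable_sets[OF this, of I] show ?thesis by (simp add: vimage_def)
qed

text \<open>For fixed \<open>w\<close> the event is a rectangle in the two uniform variables, so its
  measure factors, and integrating over \<open>w\<close> gives the claim. This expresses conditional
  independence of the copies given \<open>X\<close>. Sets \<open>I\<close> and \<open>J\<close> in
  place of single levels let \<open>UNIV\<close>, with the constant function 1, produce the
  marginals.\<close>

lemma measure_level_fun_pair:
  fixes I J :: "nat set" and a b :: "'w \<Rightarrow> real"
  assumes a: "AE w in M. 0 \<le> a w \<and> emeasure uniform01 {u. level_fun K Q (X w) u \<in> I} = ennreal (a w)"
    and b: "AE w in M. 0 \<le> b w \<and> emeasure uniform01 {u. level_fun K Q (X w) u \<in> J} = ennreal (b w)"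
    and int: "integrable M (\<lambda>w. a w * b w)"
  defines "N \<equiv> M \<Otimes>\<^sub>M (uniform01 \<Otimes>\<^sub>M uniform01)"
  shows "measure N {z \<in> space N. (\<lambda>(w, u, u'). level_fun K Q (X w) u) z \<in> I \<and>
    (\<lambda>(w, u, u'). level_fun K Q (X w) u') z \<in> J} = (\<integral>w. a w * b w \<partial>M)"
proof -
  interpret U: prob_space uniform01 by (rule prob_space_uniform01)
  interpret UU: pair_prob_space uniform01 uniform01 ..
  interpret P: pair_prob_space M "uniform01 \<Otimes>\<^sub>M uniform01" ..
  define S where "S w I = {u. level_fun K Q (X w) u \<in> I}" for w I
  have S[measurable]: "S w I \<in> sets borel" for w I
    unfolding S_def by (rule level_fun_section_measurable)
  let ?f = "\<lambda>(w, u, u'). level_fun K Q (X w) u"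
  let ?g = "\<lambda>(w, u, u'). level_fun K Q (X w) u'"
  have f: "?f \<in> measurable N (count_space UNIV)" and g: "?g \<in> measurable N (count_space UNIV)"
    unfolding split_def N_def by (intro measurable_level_fun; simp add: cond_probs_measurable)+
  let ?A = "{z \<in> space N. ?f z \<in> I \<and> ?g z \<in> J}"
  have "?A = (?f -` I \<inter> space N) \<inter> (?g -` J \<inter> space N)" by auto
  then have A: "?A \<in> sets N"
    using measurable_sets[OF f, of I] measurable_sets[OF g, of J] by auto
  have sec: "Pair w -` ?A = S w I \<times> S w J" if "w \<in> space M" for w
    using that by (auto simp: N_def S_def space_pair_measure uniform01_def)
  have "emeasure N ?A = (\<integral>\<^sup>+w. emeasure (uniform01 \<Otimes>\<^sub>M uniform01) (Pair w -` ?A) \<partial>M)"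
    using A unfolding N_def by (rule UU.emeasure_pair_measure_alt)
  also have "\<dots> = (\<integral>\<^sup>+w. emeasure uniform01 (S w I) * emeasure uniform01 (S w J) \<partial>M)"
    by (intro nn_integral_cong) (simp only: sec U.emeasure_pair_measure_Times S sets_uniform01)
  also have "\<dots> = (\<integral>\<^sup>+w. ennreal (a w * b w) \<partial>M)"
  proof (rule nn_integral_cong_AE)
    show "AE w in M. emeasure uniform01 (S w I) * emeasure uniform01 (S w J) = ennreal (a w * b w)"
      using a b by eventually_elim (simp add: S_def ennreal_mult)
  qed
  also have "\<dots> = ennreal (\<integral>w. a w * b w \<partial>M)"
  proof (rule nn_integral_eq_integral[OF int])
    show "AE w in M. 0 \<le> a w * b w" using a b by eventually_elim simp
  qed
  finally have "emeasure N ?A = ennreal (\<integral>w. a w * b w \<partial>M)" .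
  moreover have "0 \<le> (\<integral>w. a w * b w \<partial>M)"
    by (rule integral_nonneg_AE) (use a b in eventually_elim, simp)
  ultimately show ?thesis by (simp add: measure_def)
qed

text \<open>Each copy has the marginals of \<open>Y\<close>, since \<open>Q i (X w)\<close> has mean
  \<open>prob {w \<in> space M. Y w = i}\<close>, and the joint probabilities are mixed second
  moments. The formula holds for every version \<open>Q\<close>, so later proofs may choose a
  convenient one.\<close>

lemma psi_eq_moments:
  "psi M K X Y = 1 / (real K - 1) *
    (\<Sum>i=1..K. \<Sum>j=1..K.
      ((\<integral>w. Q i (X w) * Q j (X w) \<partial>M) - prob {w \<in> space M. Y w = i} * prob {w \<in> space M. Y w = j})\<^sup>2 /
      (prob {w \<in> space M. Y w = i} * prob {w \<in> space M. Y w = j}))"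
proof -
  interpret U: prob_space uniform01 by (rule prob_space_uniform01)
  have UNIV: "AE w in M. 0 \<le> (1::real) \<and> emeasure uniform01 {u. level_fun K Q (X w) u \<in> UNIV} = ennreal 1"
    using U.emeasure_space_1 by (simp add: uniform01_def)
  have single: "AE w in M. 0 \<le> Q i (X w) \<and> emeasure uniform01 {u. level_fun K Q (X w) u \<in> {i}} = ennreal (Q i (X w))"
    if i: "i \<in> {1..K}" for i
    using AE_cond_probs_nonneg AE_cond_probs_sum
  proof eventually_elim
    case (elim w)
    have "{u. level_fun K Q (X w) u = i} \<in> sets borel"
      using level_fun_section_measurable[of "X w" "{i}"] by simp
    then show ?case
      using elim i emeasure_uniform01_level_fun[of K Q "X w" i] by auto
  qed
  let ?N = "M \<Otimes>\<^sub>M (uniform01 \<Otimes>\<^sub>M uniform01)"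
  let ?f = "\<lambda>(w, u, u'). level_fun K Q (X w) u"
  let ?g = "\<lambda>(w, u, u'). level_fun K Q (X w) u'"
  have "measure ?N {z \<in> space ?N. ?f z = i} = prob {w \<in> space M. Y w = i}"
    "measure ?N {z \<in> space ?N. ?g z = i} = prob {w \<in> space M. Y w = i}" if i: "i \<in> {1..K}" for i
    using measure_level_fun_pair[OF single[OF i] UNIV] measure_level_fun_pair[OF UNIV single[OF i]]
      cond_probs_integrable[OF i] cond_probs_expectation[OF i] by simp_all
  moreover have "measure ?N {z \<in> space ?N. ?f z = i \<and> ?g z = j} = (\<integral>w. Q i (X w) * Q j (X w) \<partial>M)"
    if "i \<in> {1..K}" "j \<in> {1..K}" for i j
    using measure_level_fun_pair[OF single single integrable_cond_probs_mult] that by simp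
  ultimately show ?thesis
    unfolding psi_eq_version[OF M X Y Q] psi_version_def contingency_def Let_def
    by (intro arg_cong2[where f = "(*)"] sum.cong refl) simp
qed

text \<open>Marginalising the second copy: its weights add up to 1 almost surely, which leaves the
  mean of \<open>Q i (X w)\<close>.\<close>

lemma cond_probs_row_sum:
  assumes i: "i \<in> {1..K}"
  shows "(\<Sum>j=1..K. \<integral>w. Q i (X w) * Q j (X w) \<partial>M) = prob {w \<in> space M. Y w = i}"
proof -
  have "(\<Sum>j=1..K. \<integral>w. Q i (X w) * Q j (X w) \<partial>M) = (\<integral>w. (\<Sum>j=1..K. Q i (X w) * Q j (X w)) \<partial>M)"
    by (rule Bochner_Integration.integral_sum[symmetric]) (rule integrable_cond_probs_mult[OF i])
  also have "\<dots> = (\<integral>w. Q i (X w) \<partial>M)"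
  proof (rule integral_cong_AE)
    show "AE w in M. (\<Sum>j=1..K. Q i (X w) * Q j (X w)) = Q i (X w)"
      using AE_cond_probs_sum by eventually_elim (simp flip: sum_distrib_left)
  qed (intro borel_measurable_sum borel_measurable_times cond_probs_compose_measurable i; assumption)+
  finally show ?thesis using cond_probs_expectation[OF i] by simp
qed

lemma cond_probs_mult_nonneg:
  assumes "i \<in> {1..K}" "j \<in> {1..K}"
  shows "0 \<le> (\<integral>w. Q i (X w) * Q j (X w) \<partial>M)"
proof (rule integral_nonneg_AE)
  show "AE w in M. 0 \<le> Q i (X w) * Q j (X w)"
    using AE_cond_probs_nonneg by eventually_elim (use assms in \<open>blast intro: mult_nonneg_nonneg\<close>)
qed

text \<open>One entry of a row of nonnegative numbers is at most the row sum, which is the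
  marginal.\<close>

lemma cond_probs_mult_le:
  assumes "i \<in> {1..K}" "j \<in> {1..K}"
  shows "(\<integral>w. Q i (X w) * Q j (X w) \<partial>M) \<le> prob {w \<in> space M. Y w = i}"
  unfolding cond_probs_row_sum[OF assms(1), symmetric]
  using assms by (intro member_le_sum) (blast intro: cond_probs_mult_nonneg)+

section \<open>Range and extreme values in terms of the conditional probabilities\<close>

context
  assumes K: "2 \<le> K" and pos: "\<And>k. k \<in> {1..K} \<Longrightarrow> 0 < prob {w \<in> space M. Y w = k}"
begin

text \<open>All summands on the right are nonnegative, so this form yields the upper bound and
  reduces equality to the vanishing of each summand. The factor \<open>1 / (real K - 1)\<close>
  turns the constant of the chi-square identity into 1.\<close>

lemma one_minus_psi:
  "1 - psi M K X Y = 1 / (real K - 1) * (\<Sum>i=1..K. \<Sum>j=1..K.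
    (\<integral>w. Q i (X w) * Q j (X w) \<partial>M) *
    (prob {w \<in> space M. Y w = i} - (\<integral>w. Q i (X w) * Q j (X w) \<partial>M)) /
    (prob {w \<in> space M. Y w = i} * prob {w \<in> space M. Y w = j}))"
proof -
  have "(\<Sum>k=1..K. prob {w \<in> space M. Y w = k}) = 1"
    using sum_level_probs[OF sets.top] by (simp add: prob_space conj_commute cong: conj_cong)
  then show ?thesis
    unfolding psi_eq_moments using K
    by (subst chi_square_eq)
      (simp_all only: mult.commute cond_probs_row_sum pos finite_atLeastAtMost, simp add: field_simps)
qed

lemma psi_nonneg: "0 \<le> psi M K X Y"
  unfolding psi_eq_moments using K by (intro mult_nonneg_nonneg sum_nonneg) simp_all

lemma psi_le_1: "psi M K X Y \<le> 1"
proof -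
  have "0 \<le> 1 - psi M K X Y"
    unfolding one_minus_psi using K cond_probs_mult_nonneg cond_probs_mult_le
    by (intro mult_nonneg_nonneg sum_nonneg divide_nonneg_nonneg) auto
  then show ?thesis by simp
qed

lemma psi_eq_0_iff_AE:
  "psi M K X Y = 0 \<longleftrightarrow> (\<forall>k\<in>{1..K}. AE w in M. Q k (X w) = prob {w \<in> space M. Y w = k})"
  (is "_ \<longleftrightarrow> (\<forall>k\<in>_. AE w in M. _ = ?p k)")
proof
  assume "psi M K X Y = 0"
  then have "(\<Sum>i=1..K. \<Sum>j=1..K. ((\<integral>w. Q i (X w) * Q j (X w) \<partial>M) - ?p i * ?p j)\<^sup>2 / (?p i * ?p j)) = 0"
    unfolding psi_eq_moments using K by simp
  \<comment> \<open>A vanishing sum of nonnegative terms has vanishing terms; only the diagonal ones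
    are kept.\<close>
  then have sq: "((\<integral>w. Q k (X w) * Q k (X w) \<partial>M) - ?p k * ?p k)\<^sup>2 / (?p k * ?p k) = 0" if "k \<in> {1..K}" for k
    using that by (subst (asm) sum_sum_nonneg_eq_0_iff) (simp_all del: divide_eq_0_iff)
  show "\<forall>k\<in>{1..K}. AE w in M. Q k (X w) = ?p k"
  proof
    fix k assume k: "k \<in> {1..K}"
    have int: "integrable M (\<lambda>w. Q k (X w) * Q k (X w))" "integrable M (\<lambda>w. Q k (X w))"
      by (rule integrable_cond_probs_mult[OF k k] cond_probs_integrable[OF k])+
    have eq: "(Q k (X w) - ?p k)\<^sup>2 = Q k (X w) * Q k (X w) - 2 * ?p k * Q k (X w) + ?p k * ?p k" for w
      by (simp add: power2_eq_square algebra_simps)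
    \<comment> \<open>This integral is the variance of \<open>Q k (X w)\<close>, whose mean is
      \<open>?p k\<close>; the diagonal term forces it to be 0.\<close>
    have "(\<integral>w. (Q k (X w) - ?p k)\<^sup>2 \<partial>M) = (\<integral>w. Q k (X w) * Q k (X w) \<partial>M) - ?p k * ?p k"
      unfolding eq using int cond_probs_expectation[OF k] by (simp add: prob_space)
    also have "\<dots> = 0" using sq[OF k] pos[OF k] by simp
    finally have "(\<integral>w. (Q k (X w) - ?p k)\<^sup>2 \<partial>M) = 0" .
    moreover have "integrable M (\<lambda>w. (Q k (X w) - ?p k)\<^sup>2)"
      unfolding eq using int by simp
    ultimately have "AE w in M. (Q k (X w) - ?p k)\<^sup>2 = 0"
      by (subst (asm) integral_nonneg_eq_0_iff_AE) simp_all
    then show "AE w in M. Q k (X w) = ?p k" by simp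
  qed
next
  assume ae: "\<forall>k\<in>{1..K}. AE w in M. Q k (X w) = ?p k"
  have "(\<integral>w. Q i (X w) * Q j (X w) \<partial>M) = ?p i * ?p j" if "i \<in> {1..K}" "j \<in> {1..K}" for i j
  proof -
    have "(\<integral>w. Q i (X w) * Q j (X w) \<partial>M) = (\<integral>w. ?p i * ?p j \<partial>M)"
    proof (rule integral_cong_AE)
      show "AE w in M. Q i (X w) * Q j (X w) = ?p i * ?p j"
        using bspec[OF ae that(1)] bspec[OF ae that(2)] by eventually_elim simp
    qed (intro borel_measurable_times cond_probs_compose_measurable that, simp)
    then show ?thesis by (simp add: prob_space)
  qed
  then show "psi M K X Y = 0" unfolding psi_eq_moments by simp
qed

lemma psi_eq_1_iff_AE:
  "psi M K X Y = 1 \<longleftrightarrow> (\<forall>k\<in>{1..K}. AE w in M. Q k (X w) \<in> {0, 1})"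
proof -
  define p where "p k = prob {w \<in> space M. Y w = k}" for k
  define c where "c i j = (\<integral>w. Q i (X w) * Q j (X w) \<partial>M)" for i j
  have p: "0 < p k" if "k \<in> {1..K}" for k
    using pos[OF that] by (simp add: p_def)
  have c: "0 \<le> c i j" "c i j \<le> p i" if "i \<in> {1..K}" "j \<in> {1..K}" for i j
    using cond_probs_mult_nonneg[OF that] cond_probs_mult_le[OF that] by (simp_all add: c_def p_def)
  have row: "(\<Sum>j=1..K. c i j) = p i" if "i \<in> {1..K}" for i
    using cond_probs_row_sum[OF that] by (simp add: c_def p_def)
  \<comment> \<open>The difference \<open>p k - c k k\<close> is the integral of
    \<open>Q k (X w) * (1 - Q k (X w))\<close>, which is nonnegative almost everywhere as the weight
    lies between 0 and 1.\<close>
  have diag: "c k k = p k \<longleftrightarrow> (AE w in M. Q k (X w) \<in> {0, 1})" if k: "k \<in> {1..K}" for k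
  proof -
    have int: "integrable M (\<lambda>w. Q k (X w) * Q k (X w))" "integrable M (\<lambda>w. Q k (X w))"
      by (rule integrable_cond_probs_mult[OF k k] cond_probs_integrable[OF k])+
    have "p k - c k k = (\<integral>w. Q k (X w) - Q k (X w) * Q k (X w) \<partial>M)"
      using int cond_probs_expectation[OF k] by (simp add: p_def c_def)
    moreover have "(\<integral>w. Q k (X w) - Q k (X w) * Q k (X w) \<partial>M) = 0 \<longleftrightarrow>
        (AE w in M. Q k (X w) - Q k (X w) * Q k (X w) = 0)"
    proof (rule integral_nonneg_eq_0_iff_AE)
      show "AE w in M. 0 \<le> Q k (X w) - Q k (X w) * Q k (X w)"
        using AE_cond_probs_nonneg AE_cond_probs_le_1
        by eventually_elim (use k mult_left_le in fastforce)
    qed (use int in simp)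
    moreover have "Q k (X w) - Q k (X w) * Q k (X w) = 0 \<longleftrightarrow> Q k (X w) \<in> {0, 1}" for w
      by auto
    ultimately show ?thesis by auto
  qed
  have terms: "0 \<le> c i j * (p i - c i j) / (p i * p j)" if "i \<in> {1..K}" "j \<in> {1..K}" for i j
    using c[OF that] p[OF that(1)] p[OF that(2)] by simp
  have "psi M K X Y = 1 \<longleftrightarrow> (\<Sum>i=1..K. \<Sum>j=1..K. c i j * (p i - c i j) / (p i * p j)) = 0"
    using one_minus_psi[folded c_def p_def] K by auto
  also have "\<dots> \<longleftrightarrow> (\<forall>i\<in>{1..K}. \<forall>j\<in>{1..K}. c i j * (p i - c i j) / (p i * p j) = 0)"
    by (rule sum_sum_nonneg_eq_0_iff) (simp, rule terms)
  also have "\<dots> \<longleftrightarrow> (\<forall>k\<in>{1..K}. c k k = p k)"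
  proof (intro iffI ballI)
    fix k assume *: "\<forall>i\<in>{1..K}. \<forall>j\<in>{1..K}. c i j * (p i - c i j) / (p i * p j) = 0" and k: "k \<in> {1..K}"
    \<comment> \<open>A vanishing diagonal term leaves \<open>c k k = 0\<close> or
      \<open>c k k = p k\<close>. The first would make \<open>Q k (X w)\<close> zero almost
      everywhere and contradict the positivity of \<open>p k\<close>.\<close>
    have "p k = 0" if "c k k = 0"
    proof -
      have "(\<integral>w. Q k (X w) * Q k (X w) \<partial>M) = 0 \<longleftrightarrow> (AE w in M. Q k (X w) * Q k (X w) = 0)"
        by (rule integral_nonneg_eq_0_iff_AE) (simp_all only: integrable_cond_probs_mult k zero_le_square AE_I2)
      then have "AE w in M. Q k (X w) = 0" using that by (simp add: c_def)
      then have "(\<integral>w. Q k (X w) \<partial>M) = 0" by (rule integral_eq_zero_AE)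
      then show ?thesis using cond_probs_expectation[OF k] by (simp add: p_def)
    qed
    then show "c k k = p k" using * p[OF k] k by force
  next
    fix i j assume *: "\<forall>k\<in>{1..K}. c k k = p k" and i: "i \<in> {1..K}" and j: "j \<in> {1..K}"
    \<comment> \<open>The diagonal entry already exhausts the row sum \<open>p i\<close>, so the
      nonnegative entries beside it vanish.\<close>
    have "c i j = 0" if "i \<noteq> j"
    proof -
      have "(\<Sum>k\<in>{i, j}. c i k) \<le> (\<Sum>k=1..K. c i k)"
        using i j c(1)[OF i] by (intro sum_mono2) auto
      then show ?thesis using that row[OF i] * i c(1)[OF i j] by fastforce
    qed
    then show "c i j * (p i - c i j) / (p i * p j) = 0" using * i by (cases "i = j") auto
  qed
  finally show ?thesis using diag by blast
qed

end

end

section \<open>Independence tested on single levels of \<open>Y\<close>\<close>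

lemma indep_rvs_iff:
  "indep_rvs M borel X (count_space {1..K}) Y \<longleftrightarrow>
    (\<forall>k\<in>{1..K}. \<forall>B\<in>sets borel. prob {w \<in> space M. Y w = k \<and> X w \<in> B} =
      prob {w \<in> space M. Y w = k} * prob {w \<in> space M. X w \<in> B})"
  (is "?indep \<longleftrightarrow> ?prod")
proof -
  have sX: "sets (vimage_algebra (space M) X borel) = {X -` B \<inter> space M |B. B \<in> sets borel}"
    by (rule sets_vimage_algebra2) simp
  have sY: "sets (vimage_algebra (space M) Y (count_space {1..K})) = {Y -` C \<inter> space M |C. C \<subseteq> {1..K}}"
    using measurable_space[OF Y] by (subst sets_vimage_algebra2) auto
  show ?thesis
  proof
    assume ?indep
    then have ind: "indep_set {X -` B \<inter> space M |B. B \<in> sets borel} {Y -` C \<inter> space M |C. C \<subseteq> {1..K}}"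
      by (simp only: indep_rvs_def sX sY)
    show ?prod
    proof (intro ballI)
      fix k and B :: "'h set" assume k: "k \<in> {1..K}" and B: "B \<in> sets borel"
      have "prob ((X -` B \<inter> space M) \<inter> (Y -` {k} \<inter> space M)) = prob (X -` B \<inter> space M) * prob (Y -` {k} \<inter> space M)"
        by (rule indep_setD[OF ind]) (use k B in blast)+
      moreover have "(X -` B \<inter> space M) \<inter> (Y -` {k} \<inter> space M) = {w \<in> space M. Y w = k \<and> X w \<in> B}"
        "X -` B \<inter> space M = {w \<in> space M. X w \<in> B}" "Y -` {k} \<inter> space M = {w \<in> space M. Y w = k}"
        by auto
      ultimately show "prob {w \<in> space M. Y w = k \<and> X w \<in> B} = prob {w \<in> space M. Y w = k} * prob {w \<in> space M. X w \<in> B}"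
        by (simp only: mult.commute)
    qed
  next
    assume ?prod
    \<comment> \<open>Every event of the sigma-algebra of \<open>Y\<close> is a finite disjoint
      union of level sets, so the product rule extends from single levels by additivity.\<close>
    have union: "prob (Y -` C \<inter> E) = (\<Sum>k\<in>C. prob {w \<in> space M. Y w = k \<and> w \<in> E})"
      if C: "C \<subseteq> {1..K}" and [measurable]: "E \<in> sets M" for C E
    proof -
      have "prob (\<Union>k\<in>C. {w \<in> space M. Y w = k \<and> w \<in> E}) = (\<Sum>k\<in>C. prob {w \<in> space M. Y w = k \<and> w \<in> E})"
        using finite_subset[OF C] by (intro finite_measure_finite_Union) (auto simp: disjoint_family_on_def)
      moreover have "(\<Union>k\<in>C. {w \<in> space M. Y w = k \<and> w \<in> E}) = Y -` C \<inter> E"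
        using sets.sets_into_space[OF that(2)] by auto
      ultimately show ?thesis by simp
    qed
    have "indep_set {X -` B \<inter> space M |B. B \<in> sets borel} {Y -` C \<inter> space M |C. C \<subseteq> {1..K}}"
    proof (rule indep_setI)
      show "{X -` B \<inter> space M |B. B \<in> sets borel} \<subseteq> events"
        using measurable_sets[OF X] by blast
      show "{Y -` C \<inter> space M |C. C \<subseteq> {1..K}} \<subseteq> events"
        using measurable_sets[OF Y] by (auto simp: Pow_def)
      fix a b assume "a \<in> {X -` B \<inter> space M |B. B \<in> sets borel}" "b \<in> {Y -` C \<inter> space M |C. C \<subseteq> {1..K}}"
      then obtain B C where a: "a = X -` B \<inter> space M" and B: "B \<in> sets borel"
        and b: "b = Y -` C \<inter> space M" and C: "C \<subseteq> {1..K}" by blast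
      have "prob (a \<inter> b) = prob (Y -` C \<inter> a)"
        unfolding a b by (rule arg_cong[where f = prob]) auto
      also have "\<dots> = (\<Sum>k\<in>C. prob {w \<in> space M. Y w = k \<and> w \<in> a})"
        using measurable_sets[OF X B] a by (intro union[OF C]) simp
      also have "\<dots> = (\<Sum>k\<in>C. prob {w \<in> space M. Y w = k \<and> X w \<in> B})"
        unfolding a by (intro sum.cong arg_cong[where f = prob]) auto
      also have "\<dots> = (\<Sum>k\<in>C. prob {w \<in> space M. Y w = k} * prob {w \<in> space M. X w \<in> B})"
        using \<open>?prod\<close> B C by (intro sum.cong refl) blast
      \<comment> \<open>The condition \<open>w \<in> space M\<close> is inserted so that
        \<open>union\<close> can be read backwards with the whole space as \<open>E\<close>.\<close>
      also have "\<dots> = (\<Sum>k\<in>C. prob {w \<in> space M. Y w = k \<and> w \<in> space M}) * prob {w \<in> space M. X w \<in> B}"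
        unfolding sum_distrib_right by (intro sum.cong arg_cong2[where f = "(*)"] arg_cong[where f = prob]) auto
      also have "\<dots> = prob b * prob a"
        unfolding union[OF C sets.top, symmetric] a b
        by (intro arg_cong2[where f = "(*)"] arg_cong[where f = prob]) auto
      finally show "prob (a \<inter> b) = prob a * prob b" by simp
    qed
    then show ?indep by (simp only: indep_rvs_def sX sY)
  qed
qed

section \<open>The extreme values as independence and as functional dependence\<close>

context
  assumes K: "2 \<le> K" and pos: "\<And>k. k \<in> {1..K} \<Longrightarrow> 0 < prob {w \<in> space M. Y w = k}"
begin

lemma psi_eq_0_iff_indep: "psi M K X Y = 0 \<longleftrightarrow> indep_rvs M borel X (count_space {1..K}) Y"
proof
  obtain Q where Q: "is_cond_probs M K X Y Q"
    using is_cond_probs_exists[OF M X Y] by blast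
  assume "psi M K X Y = 0"
  then have ae: "AE w in M. Q k (X w) = prob {w \<in> space M. Y w = k}" if "k \<in> {1..K}" for k
    using that psi_eq_0_iff_AE[OF Q K pos] by blast
  show "indep_rvs M borel X (count_space {1..K}) Y"
    unfolding indep_rvs_iff
  proof (intro ballI)
    fix k and B :: "'h set" assume k: "k \<in> {1..K}" and B[measurable]: "B \<in> sets borel"
    have [measurable]: "Q k \<in> borel_measurable borel" by (rule cond_probs_measurable[OF Q k])
    have "prob {w \<in> space M. Y w = k \<and> X w \<in> B} = (\<integral>w. indicator B (X w) * Q k (X w) \<partial>M)"
      by (rule cond_probs_integral[OF Q k B, symmetric])
    also have "\<dots> = (\<integral>w. indicator {w \<in> space M. X w \<in> B} w * prob {w \<in> space M. Y w = k} \<partial>M)"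
    proof (rule integral_cong_AE)
      show "AE w in M. indicator B (X w) * Q k (X w) =
          indicator {w \<in> space M. X w \<in> B} w * prob {w \<in> space M. Y w = k}"
        using ae[OF k] AE_space by eventually_elim (simp add: indicator_def)
    qed measurable
    also have "\<dots> = prob {w \<in> space M. Y w = k} * prob {w \<in> space M. X w \<in> B}"
      by simp
    finally show "prob {w \<in> space M. Y w = k \<and> X w \<in> B} =
      prob {w \<in> space M. Y w = k} * prob {w \<in> space M. X w \<in> B}" .
  qed
next
  assume indep: "indep_rvs M borel X (count_space {1..K}) Y"
  \<comment> \<open>Independence says exactly that the constants pass the test on Borel sets. They
    therefore form a version, and for this version the criterion for \<open>psi\<close> to be 0 is
    trivial.\<close>
  have "is_cond_probs M K X Y (\<lambda>k x. prob {w \<in> space M. Y w = k})"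
    unfolding is_cond_probs_iff
  proof (intro ballI conjI)
    fix k and B :: "'h set" assume k: "k \<in> {1..K}" and B[measurable]: "B \<in> sets borel"
    have "(\<integral>w. indicator B (X w) * prob {w \<in> space M. Y w = k} \<partial>M) =
        (\<integral>w. indicator {w \<in> space M. X w \<in> B} w * prob {w \<in> space M. Y w = k} \<partial>M)"
      by (intro Bochner_Integration.integral_cong) (auto simp: indicator_def)
    also have "\<dots> = prob {w \<in> space M. Y w = k \<and> X w \<in> B}"
      using indep k B unfolding indep_rvs_iff by simp
    finally show "(\<integral>w. indicator B (X w) * prob {w \<in> space M. Y w = k} \<partial>M) =
      prob {w \<in> space M. Y w = k \<and> X w \<in> B}" .
  qed simp_all
  from psi_eq_0_iff_AE[OF this K pos] show "psi M K X Y = 0" by simp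
qed

lemma psi_eq_1_iff_function:
  "psi M K X Y = 1 \<longleftrightarrow>
    (\<exists>h\<in>measurable (borel :: 'h measure) (count_space {1..K}). AE w in M. Y w = h (X w))"
proof
  obtain Q where Q: "is_cond_probs M K X Y Q"
    using is_cond_probs_exists[OF M X Y] by blast
  assume "psi M K X Y = 1"
  then have ae01: "\<forall>k\<in>{1..K}. AE w in M. Q k (X w) \<in> {0, 1}"
    using psi_eq_1_iff_AE[OF Q K pos] by blast
  \<comment> \<open>Where one weight is 1 and the others are 0, every threshold in the open unit
    interval selects that level; 1/2 is an arbitrary choice. The value 1 keeps \<open>h\<close>
    inside \<open>{1..K}\<close> at points where the weights do not behave and the minimum may be no
    level.\<close>
  define h where "h x = (if level_fun K Q x (1/2) \<in> {1..K} then level_fun K Q x (1/2) else 1)" for x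
  have "(\<lambda>x. level_fun K Q ((\<lambda>x. x) x) ((\<lambda>_. 1/2) x)) \<in> measurable borel (count_space UNIV)"
    by (rule measurable_level_fun) (simp_all only: measurable_ident_sets borel_measurable_const cond_probs_measurable[OF Q])
  then have "h \<in> measurable borel (count_space {1..K})"
    unfolding h_def by (rule measurable_compose) (use K in auto)
  moreover have "AE w in M. Y w = h (X w)"
  proof -
    \<comment> \<open>Testing the conditional probability on the zero set of \<open>Q k\<close>
      shows that level \<open>k\<close> almost never occurs there. So the level that occurs has
      nonzero weight, hence weight 1.\<close>
    have "AE w in M. Y w = k \<longrightarrow> Q k (X w) \<noteq> 0" if k: "k \<in> {1..K}" for k
    proof -
      have [measurable]: "Q k \<in> borel_measurable borel" by (rule cond_probs_measurable[OF Q k])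
      define B where "B = {x. Q k x = 0}"
      have B[measurable]: "B \<in> sets borel" unfolding B_def by measurable
      have "(\<lambda>w. indicator B (X w) * Q k (X w)) = (\<lambda>w. 0)"
        by (auto simp: B_def indicator_def)
      then have "prob {w \<in> space M. Y w = k \<and> X w \<in> B} = 0"
        using cond_probs_integral[OF Q k B] by simp
      then have "AE w in M. w \<notin> {w \<in> space M. Y w = k \<and> X w \<in> B}"
        by (subst (asm) prob_eq_0) simp_all
      then show ?thesis using AE_space by eventually_elim (simp add: B_def)
    qed
    then have "AE w in M. \<forall>k\<in>{1..K}. Y w = k \<longrightarrow> Q k (X w) \<noteq> 0"
      by (intro AE_finite_allI) auto
    moreover have "AE w in M. \<forall>k\<in>{1..K}. Q k (X w) \<in> {0, 1}"
      using ae01 by (intro AE_finite_allI) auto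
    ultimately show ?thesis
      using AE_cond_probs_nonneg[OF Q] AE_cond_probs_sum[OF Q] AE_space
    proof eventually_elim
      case (elim w)
      have k: "Y w \<in> {1..K}" using measurable_space[OF Y elim(5)] by simp
      then have one: "Q (Y w) (X w) = 1" using elim(1,2) by blast
      \<comment> \<open>A weight of 1 exhausts the total mass: the partial sum before
        \<open>Y w\<close> is 0 and the one including it is 1, so the threshold 1/2 is crossed
        exactly at \<open>Y w\<close>.\<close>
      have "(\<Sum>j=1..Y w. Q j (X w)) \<le> (\<Sum>j=1..K. Q j (X w))"
        using k elim(3) by (intro sum_mono2) auto
      moreover have "0 \<le> (\<Sum>j=1..Y w - 1. Q j (X w))"
        using k elim(3) by (intro sum_nonneg) auto
      moreover have "(\<Sum>j=1..Y w. Q j (X w)) = (\<Sum>j=1..Y w - 1. Q j (X w)) + Q (Y w) (X w)"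
        using k by (cases "Y w") auto
      ultimately have "level_fun K Q (X w) (1/2) = Y w"
        using elim(3,4) k one by (subst level_fun_eq_iff) auto
      then show ?case using k by (simp add: h_def)
    qed
  qed
  ultimately show "\<exists>h\<in>measurable borel (count_space {1..K}). AE w in M. Y w = h (X w)" by blast
next
  assume "\<exists>h\<in>measurable (borel :: 'h measure) (count_space {1..K}). AE w in M. Y w = h (X w)"
  then obtain h where h: "h \<in> measurable (borel :: 'h measure) (count_space {1..K})"
    and ae: "AE w in M. Y w = h (X w)" by blast
  have hm[measurable]: "h -` {k} \<in> sets borel" if "k \<in> {1..K}" for k
    using measurable_sets[OF h, of "{k}"] that by simp
  \<comment> \<open>Given \<open>X = x\<close>, the variable \<open>Y\<close> is concentrated at
    \<open>h x\<close>, so the indicators of the fibres of \<open>h\<close> form a version with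
    values 0 and 1.\<close>
  have "is_cond_probs M K X Y (\<lambda>k x. indicator (h -` {k}) x)"
    unfolding is_cond_probs_iff
  proof (intro ballI conjI)
    fix k assume k: "k \<in> {1..K}"
    note [measurable] = hm[OF k]
    show "(indicator (h -` {k}) :: 'h \<Rightarrow> real) \<in> borel_measurable borel" by measurable
    show "integrable M (\<lambda>w. indicator (h -` {k}) (X w) :: real)"
    proof (rule integrable_const_bound[where B = 1])
      show "AE w in M. norm (indicator (h -` {k}) (X w) :: real) \<le> 1"
        by (rule AE_I2) (simp add: indicator_def)
    qed measurable
    fix B :: "'h set" assume [measurable]: "B \<in> sets borel"
    have "(\<integral>w. indicator B (X w) * indicator (h -` {k}) (X w) \<partial>M) =
        (\<integral>w. indicator {w \<in> space M. Y w = k \<and> X w \<in> B} w \<partial>M :: real)"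
    proof (rule integral_cong_AE)
      show "AE w in M. indicator B (X w) * indicator (h -` {k}) (X w) =
          (indicator {w \<in> space M. Y w = k \<and> X w \<in> B} w :: real)"
        using ae AE_space by eventually_elim (auto simp: indicator_def)
    qed measurable
    then show "(\<integral>w. indicator B (X w) * indicator (h -` {k}) (X w) \<partial>M) = prob {w \<in> space M. Y w = k \<and> X w \<in> B}"
      by simp
  qed
  from psi_eq_1_iff_AE[OF this K pos] show "psi M K X Y = 1"
    by (simp add: indicator_def)
qed

end

end

section \<open>Invariance under relabelling of the levels\<close>

lemma psi_relabel:
  fixes X :: "'w \<Rightarrow> 'h::metric_space"
  assumes M: "prob_space M" and X: "X \<in> borel_measurable M"
    and Y: "Y \<in> measurable M (count_space {1..K})" and l: "bij_betw l {1..K} {1..K}"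
  shows "psi M K X (\<lambda>w. l (Y w)) = psi M K X Y"
proof -
  obtain Q where Q: "is_cond_probs M K X Y Q"
    using is_cond_probs_exists[OF M X Y] by blast
  have lY: "(\<lambda>w. l (Y w)) \<in> measurable M (count_space {1..K})"
    by (rule measurable_compose[OF Y]) (use bij_betwE[OF l] in auto)
  \<comment> \<open>Level \<open>l k\<close> of the relabelled variable is level \<open>k\<close> of
    \<open>Y\<close>, so a version for it arises by permuting the weights with the inverse of
    \<open>l\<close>. Reindexing both sums of the moment formula then gives equality.\<close>
  define Q' where "Q' k = Q (inv_into {1..K} l k)" for k
  have l_iff: "l (Y w) = l k \<longleftrightarrow> Y w = k" if "w \<in> space M" "k \<in> {1..K}" for w k
    using inj_on_eq_iff[OF bij_betw_imp_inj_on[OF l], of "Y w" k] measurable_space[OF Y that(1)] that(2) by simp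
  have Q'_l: "Q' (l k) = Q k" if "k \<in> {1..K}" for k
    using that l by (simp add: Q'_def bij_betw_def)
  \<comment> \<open>The predicate \<open>P\<close> covers the joint events with \<open>X\<close>
    and, as the constant \<open>True\<close>, the marginal ones.\<close>
  have event: "{w \<in> space M. l (Y w) = l k \<and> P w} = {w \<in> space M. Y w = k \<and> P w}"
    if "k \<in> {1..K}" for k P
    using l_iff that by blast
  have "is_cond_probs M K X (\<lambda>w. l (Y w)) Q'"
    unfolding is_cond_probs_iff[OF M X lY]
  proof
    fix k' assume "k' \<in> {1..K}"
    then obtain k where k: "k \<in> {1..K}" and k': "k' = l k"
      using l unfolding bij_betw_def by blast
    show "Q' k' \<in> borel_measurable borel \<and> integrable M (\<lambda>w. Q' k' (X w)) \<and>
        (\<forall>B\<in>sets borel. (\<integral>w. indicator B (X w) * Q' k' (X w) \<partial>M) =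
          measure M {w \<in> space M. l (Y w) = k' \<and> X w \<in> B})"
      unfolding k' Q'_l[OF k] event[OF k] using bspec[OF iffD1[OF is_cond_probs_iff[OF M X Y] Q] k] .
  qed
  note psi' = psi_eq_moments[OF M X lY this]
  have p: "measure M {w \<in> space M. l (Y w) = l k} = measure M {w \<in> space M. Y w = k}" if "k \<in> {1..K}" for k
    using event[OF that, of "\<lambda>_. True"] by simp
  have reindex: "(\<Sum>i=1..K. \<Sum>j=1..K. F i j) = (\<Sum>i=1..K. \<Sum>j=1..K. F (l i) (l j))" for F :: "nat \<Rightarrow> nat \<Rightarrow> real"
    using sum.reindex_bij_betw[OF l, of "\<lambda>i. \<Sum>j=1..K. F i (l j)"] sum.reindex_bij_betw[OF l, of "F i" for i]
    by simp
  show ?thesis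
    unfolding psi' psi_eq_moments[OF M X Y Q]
    by (subst reindex, intro arg_cong2[where f = "(*)"] sum.cong refl) (simp only: Q'_l p)
qed

theorem theorem1:
  fixes M :: "'w measure" and X :: "'w \<Rightarrow> 'h::metric_space" and Y :: "'w \<Rightarrow> nat" and K :: nat
  assumes "prob_space M"
    and "separable_space (euclidean :: 'h topology)"
    and "X \<in> measurable M borel"
    and "K \<ge> 2"
    and "Y \<in> measurable M (count_space {1..K})"
    and "\<And>k. k \<in> {1..K} \<Longrightarrow> measure M {w \<in> space M. Y w = k} > 0"
  shows "(0 \<le> psi M K X Y \<and> psi M K X Y \<le> 1) \<and>
    (psi M K X Y = 0 \<longleftrightarrow> indep_rvs M borel X (count_space {1..K}) Y) \<and>
    (psi M K X Y = 1 \<longleftrightarrow>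
       (\<exists>h \<in> measurable (borel :: 'h measure) (count_space {1..K}). AE w in M. Y w = h (X w))) \<and>
    (\<forall>l. bij_betw l {1..K} {1..K} \<longrightarrow> psi M K X Y = psi M K X (\<lambda>w. l (Y w)))"
proof (intro conjI allI impI)
  note rvs = assms(1,3,5) and K_pos = assms(4,6)
  \<comment> \<open>The two bounds were derived relative to a version of the conditional
    probabilities, so one is fixed here.\<close>
  obtain Q where Q: "is_cond_probs M K X Y Q"
    using is_cond_probs_exists[OF rvs] by blast
  show "0 \<le> psi M K X Y" "psi M K X Y \<le> 1"
    using psi_nonneg[OF rvs Q K_pos] psi_le_1[OF rvs Q K_pos] by blast+
  show "psi M K X Y = 0 \<longleftrightarrow> indep_rvs M borel X (count_space {1..K}) Y"
    by (rule psi_eq_0_iff_indep[OF rvs K_pos])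
  show "psi M K X Y = 1 \<longleftrightarrow>
      (\<exists>h \<in> measurable (borel :: 'h measure) (count_space {1..K}). AE w in M. Y w = h (X w))"
    by (rule psi_eq_1_iff_function[OF rvs K_pos])
  show "psi M K X Y = psi M K X (\<lambda>w. l (Y w))" if "bij_betw l {1..K} {1..K}" for l
    by (rule psi_relabel[OF rvs that, symmetric])
qed

end
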